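(* Let $X\subset\mathbb{R}^d$ be a compact convex set, let $1\le n\le N$ be integers, let $(q_k,p_k)\in\mathbb{R}^d\times\mathbb{R}$ for $k\in[N]=\{1,\dots,N\}$, and let $\|\cdot\|$ be a norm on $\mathbb{R}^{d+1}$ with dual norm $\|\cdot\|_*$. For nonempty $S\subseteq[N]$ put $u_S(x)=\max_{k\in S}(\langle q_k,x\rangle-p_k)$, and let $u_N:=u_{[N]}$. Let $$\mathcal{E}(n,N)=\min_{S\subseteq[N],\,|S|=n}\ \max_{k\in[N]}\ \min_{l\in S}\ \|(q_k,p_k)-(q_l,p_l)\|,$$ and let $S$ be an optimal solution of this minimization problem. Then for all $x\in X$, $$0\le u_N(x)-u_S(x)\le \mathcal{E}(n,N)\,\|(x,-1)\|_*.$$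
   Context: The dual norm is taken with respect to the standard Euclidean pairing on $\mathbb{R}^{d+1}$: $\|z\|_*=\sup_{\|w\|\le1}\langle w,z\rangle$. *)

theory Defs
  imports "HOL-Analysis.Analysis"
begin

definition is_norm :: "('v::real_vector \<Rightarrow> real) \<Rightarrow> bool" where
  "is_norm nrm \<longleftrightarrow>
     (\<forall>z. 0 \<le> nrm z) \<and>
     (\<forall>z. nrm z = 0 \<longleftrightarrow> z = 0) \<and>
     (\<forall>z w. nrm (z + w) \<le> nrm z + nrm w) \<and>
     (\<forall>c z. nrm (c *\<^sub>R z) = \<bar>c\<bar> * nrm z)"

(* The supremum is one of reals; the set is nonempty and bounded above whenever nrm is a norm
   on a finite-dimensional space. *)
definition dual_norm :: "('v::real_inner \<Rightarrow> real) \<Rightarrow> 'v \<Rightarrow> real" where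
  "dual_norm nrm z = (SUP w\<in>{w. nrm w \<le> 1}. w \<bullet> z)"

definition max_affine ::
  "(nat \<Rightarrow> 'v::real_inner) \<Rightarrow> (nat \<Rightarrow> real) \<Rightarrow> nat set \<Rightarrow> 'v \<Rightarrow> real" where
  "max_affine q p S x = Max ((\<lambda>k. q k \<bullet> x - p k) ` S)"

definition cover_radius ::
  "('v::real_vector \<times> real \<Rightarrow> real) \<Rightarrow> (nat \<Rightarrow> 'v) \<Rightarrow> (nat \<Rightarrow> real) \<Rightarrow> nat \<Rightarrow> nat set \<Rightarrow> real" where
  "cover_radius nrm q p N S =
     Max ((\<lambda>k. Min ((\<lambda>l. nrm ((q k, p k) - (q l, p l))) ` S)) ` {1..N})"

definition selection_error ::
  "('v::real_vector \<times> real \<Rightarrow> real) \<Rightarrow> (nat \<Rightarrow> 'v) \<Rightarrow> (nat \<Rightarrow> real) \<Rightarrow> nat \<Rightarrow> nat \<Rightarrow> real" where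
  "selection_error nrm q p n N =
     Min (cover_radius nrm q p N ` {S. S \<subseteq> {1..N} \<and> card S = n})"

end

theory Submission
  imports Defs
begin

text \<open>
  Every affine piece is a linear functional of its coefficients: the value of piece \<open>k\<close> at \<open>x\<close>
  is the Euclidean pairing of \<open>(q k, p k)\<close> with \<open>(x, -1)\<close>. So if the piece \<open>k\<close> is active at \<open>x\<close>
  and \<open>l\<close> is the selected piece nearest to it, then replacing \<open>k\<close> by \<open>l\<close> costs at most
  \<open>\<parallel>(q k, p k) - (q l, p l)\<parallel> * \<parallel>(x, -1)\<parallel>\<^sub>*\<close>, by duality (\<open>inner_le_norm_times_dual_norm\<close>).
  The first factor is at most the cover radius of the selection
  (\<open>max_affine_le_add_cover_radius\<close>), and for an optimal selection that radius is the minimum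
  defining the selection error.

  The duality inequality is where analysis enters: the supremum in the dual norm is
  taken over a set of reals, so it dominates its elements only once that set is known to be
  bounded above. This follows from the compactness of the Euclidean sphere, which makes every norm
  dominate a multiple of the Euclidean one (\<open>is_norm_dominates_norm\<close>).
\<close>

lemma is_normD:
  assumes "is_norm nrm"
  shows "nrm 0 = 0" and "z \<noteq> 0 \<Longrightarrow> 0 < nrm z"
    and "nrm (z + w) \<le> nrm z + nrm w" and "nrm (c *\<^sub>R z) = \<bar>c\<bar> * nrm z"
  using assms by (auto simp: is_norm_def less_eq_real_def)

lemma is_norm_convex:
  assumes "is_norm nrm"
  shows "convex_on UNIV nrm"
proof (rule convex_onI)
  fix t :: real and x y :: 'a
  assume "0 < t" "t < 1"
  have "nrm ((1 - t) *\<^sub>R x + t *\<^sub>R y) \<le> nrm ((1 - t) *\<^sub>R x) + nrm (t *\<^sub>R y)"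
    by (rule is_normD(3)[OF assms])
  also have "\<dots> = (1 - t) * nrm x + t * nrm y"
    using \<open>0 < t\<close> \<open>t < 1\<close> by (simp add: is_normD(4)[OF assms])
  finally show "nrm ((1 - t) *\<^sub>R x + t *\<^sub>R y) \<le> (1 - t) * nrm x + t * nrm y" .
qed simp

text \<open>
  Convexity makes \<open>nrm\<close> continuous, so it attains a positive minimum on the compact unit sphere;
  homogeneity extends the resulting bound to the whole space.
\<close>

lemma is_norm_dominates_norm:
  fixes nrm :: "'v::euclidean_space \<Rightarrow> real"
  assumes "is_norm nrm"
  obtains c where "0 < c" "\<And>z. c * norm z \<le> nrm z"
proof -
  have "continuous_on UNIV nrm"
    by (rule convex_on_continuous[OF open_UNIV is_norm_convex[OF assms]])
  then have "continuous_on (sphere 0 1) nrm"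
    by (rule continuous_on_subset) simp
  moreover have "sphere (0::'v) 1 \<noteq> {}"
    by simp
  ultimately obtain u where u: "u \<in> sphere 0 1" "\<And>v. v \<in> sphere 0 1 \<Longrightarrow> nrm u \<le> nrm v"
    using continuous_attains_inf[of "sphere 0 1" nrm] by auto
  have "0 < nrm u"
    using u(1) by (intro is_normD(2)[OF assms]) auto
  moreover have "nrm u * norm z \<le> nrm z" for z
  proof (cases "z = 0")
    case False
    have "nrm u * norm z \<le> nrm (inverse (norm z) *\<^sub>R z) * norm z"
      using False by (intro mult_right_mono u(2)) auto
    also have "\<dots> = nrm z"
      using False by (simp add: is_normD(4)[OF assms])
    finally show ?thesis .
  qed (simp add: is_normD(1)[OF assms])
  ultimately show ?thesis
    by (rule that)
qed

lemma bdd_above_dual_norm: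
  fixes nrm :: "'v::euclidean_space \<Rightarrow> real"
  assumes "is_norm nrm"
  shows "bdd_above ((\<lambda>w. w \<bullet> z) ` {w. nrm w \<le> 1})"
proof -
  obtain c where c: "0 < c" "\<And>z. c * norm z \<le> nrm z"
    using is_norm_dominates_norm[OF assms] by blast
  show ?thesis
  proof (rule bdd_aboveI2)
    fix w assume "w \<in> {w. nrm w \<le> 1}"
    then have "c * norm w \<le> 1"
      using c(2)[of w] by simp
    then have "norm w \<le> 1 / c"
      using c(1) by (simp add: field_simps)
    then have "norm w * norm z \<le> 1 / c * norm z"
      by (rule mult_right_mono) simp
    then show "w \<bullet> z \<le> 1 / c * norm z"
      using norm_cauchy_schwarz[of w z] by linarith
  qed
qed

lemma inner_le_dual_norm:
  fixes nrm :: "'v::euclidean_space \<Rightarrow> real"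
  assumes "is_norm nrm" and "nrm w \<le> 1"
  shows "w \<bullet> z \<le> dual_norm nrm z"
  unfolding dual_norm_def
  by (rule cSUP_upper) (use assms bdd_above_dual_norm in auto)

lemma dual_norm_nonneg:
  fixes nrm :: "'v::euclidean_space \<Rightarrow> real"
  assumes "is_norm nrm"
  shows "0 \<le> dual_norm nrm z"
proof -
  have "nrm 0 \<le> 1"
    by (simp add: is_normD(1)[OF assms])
  from inner_le_dual_norm[OF assms this] show ?thesis
    by simp
qed

lemma inner_le_norm_times_dual_norm:
  fixes nrm :: "'v::euclidean_space \<Rightarrow> real"
  assumes "is_norm nrm"
  shows "w \<bullet> z \<le> nrm w * dual_norm nrm z"
proof (cases "w = 0")
  case False
  then have pos: "0 < nrm w"
    by (rule is_normD(2)[OF assms])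
  then have "nrm (inverse (nrm w) *\<^sub>R w) \<le> 1"
    by (simp add: is_normD(4)[OF assms])
  from inner_le_dual_norm[OF assms this]
  have "inverse (nrm w) * (w \<bullet> z) \<le> dual_norm nrm z"
    by simp
  with pos show ?thesis
    by (simp add: field_simps)
qed (simp add: is_normD(1)[OF assms])

lemma max_affine_mono:
  assumes "finite T" "S \<noteq> {}" "S \<subseteq> T"
  shows "max_affine q p S x \<le> max_affine q p T x"
  unfolding max_affine_def using assms by (intro Max_mono) auto

text \<open>
  The bound holds for any nonempty selection, with the radius of that selection in place of the
  optimal error: the piece \<open>k\<close> below attains the full maximum, and \<open>l\<close> is a selected piece nearest
  to it.
\<close>

lemma max_affine_le_add_cover_radius:
  fixes q :: "nat \<Rightarrow> 'v::euclidean_space"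
  assumes nrm: "is_norm nrm" and "finite S" "S \<noteq> {}" and "1 \<le> N"
  shows "max_affine q p {1..N} x
           \<le> max_affine q p S x + cover_radius nrm q p N S * dual_norm nrm (x, -1)"
proof -
  let ?d = "\<lambda>k l. nrm ((q k, p k) - (q l, p l))"
  have "max_affine q p {1..N} x \<in> (\<lambda>k. q k \<bullet> x - p k) ` {1..N}"
    unfolding max_affine_def using \<open>1 \<le> N\<close> by (intro Max_in) auto
  then obtain k where k: "k \<in> {1..N}" "max_affine q p {1..N} x = q k \<bullet> x - p k"
    by blast
  have "Min (?d k ` S) \<in> ?d k ` S"
    using assms by (intro Min_in) auto
  then obtain l where l: "l \<in> S" "Min (?d k ` S) = ?d k l"
    by blast
  have near: "?d k l \<le> cover_radius nrm q p N S"
    unfolding cover_radius_def l(2)[symmetric] using k(1) by (intro Max_ge) auto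
  have "(q k \<bullet> x - p k) - (q l \<bullet> x - p l) = ((q k, p k) - (q l, p l)) \<bullet> (x, -1)"
    by (simp add: inner_diff_left)
  also have "\<dots> \<le> ?d k l * dual_norm nrm (x, -1)"
    by (rule inner_le_norm_times_dual_norm[OF nrm])
  also have "\<dots> \<le> cover_radius nrm q p N S * dual_norm nrm (x, -1)"
    by (rule mult_right_mono[OF near dual_norm_nonneg[OF nrm]])
  finally have "(q k \<bullet> x - p k) - (q l \<bullet> x - p l)
      \<le> cover_radius nrm q p N S * dual_norm nrm (x, -1)" .
  moreover have "q l \<bullet> x - p l \<le> max_affine q p S x"
    unfolding max_affine_def using \<open>finite S\<close> l(1) by (intro Max_ge) auto
  ultimately show ?thesis
    using k(2) by linarith
qed

lemma cover_radius_optimal_eq_selection_error: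
  assumes "is_arg_min (cover_radius nrm q p N) (\<lambda>T. T \<subseteq> {1..N} \<and> card T = n) S"
  shows "cover_radius nrm q p N S = selection_error nrm q p n N"
proof -
  have "finite {T. T \<subseteq> {1..N} \<and> card T = n}"
    by (rule finite_subset[of _ "Pow {1..N}"]) auto
  then show ?thesis
    unfolding selection_error_def using assms
    by (intro Min_eqI[symmetric]) (auto simp: is_arg_min_linorder)
qed

theorem proposition2:
  fixes X :: "(real ^ 'd) set"
    and n N :: nat
    and q :: "nat \<Rightarrow> real ^ 'd"
    and p :: "nat \<Rightarrow> real"
    and nrm :: "(real ^ 'd) \<times> real \<Rightarrow> real"
    and S :: "nat set"
  assumes "compact X" and "convex X"
    and "1 \<le> n" and "n \<le> N"
    and "is_norm nrm"
    and "is_arg_min (cover_radius nrm q p N) (\<lambda>T. T \<subseteq> {1..N} \<and> card T = n) S"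
  shows "\<forall>x\<in>X.
           0 \<le> max_affine q p {1..N} x - max_affine q p S x \<and>
           max_affine q p {1..N} x - max_affine q p S x
             \<le> selection_error nrm q p n N * dual_norm nrm (x, -1)"
proof
  fix x assume "x \<in> X"
  from assms(6) have S: "S \<subseteq> {1..N}" "card S = n"
    by (auto simp: is_arg_min_def)
  then have "finite S"
    using finite_subset by blast
  have "S \<noteq> {}"
    using S(2) \<open>1 \<le> n\<close> by auto
  have "1 \<le> N"
    using \<open>1 \<le> n\<close> \<open>n \<le> N\<close> by simp
  show "0 \<le> max_affine q p {1..N} x - max_affine q p S x \<and>
      max_affine q p {1..N} x - max_affine q p S x
        \<le> selection_error nrm q p n N * dual_norm nrm (x, -1)"
    using max_affine_mono[OF finite_atLeastAtMost \<open>S \<noteq> {}\<close> S(1), of q p x]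
      max_affine_le_add_cover_radius[OF \<open>is_norm nrm\<close> \<open>finite S\<close> \<open>S \<noteq> {}\<close> \<open>1 \<le> N\<close>, of q p x]
    unfolding cover_radius_optimal_eq_selection_error[OF assms(6)] by linarith
qed

end
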